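(* Let $H$ be a complex Hilbert space and let $A,B\in B(H)$ be such that $AB=BA$. If $A$ is normal and $B$ is hyponormal, then $\big||A|-|B|\big|\leq |A-B|$.
   Context: $B(H)$ denotes the algebra of bounded linear operators on $H$. An operator $T\in B(H)$ is positive, $T\geq 0$, if $\langle Tx,x\rangle\geq 0$ for all $x\in H$; for self-adjoint $S,T$, $S\leq T$ means $T-S\geq 0$. For $T\in B(H)$, $|T|=\sqrt{T^*T}$ denotes the absolute value (modulus) of $T$, i.e. the unique positive square root of $T^*T$; thus $\big||A|-|B|\big|$ is the absolute value of the operator $|A|-|B|$. An operator $T$ is normal if $TT^*=T^*T$, and hyponormal if $TT^*\leq T^*T$, equivalently $\|T^*x\|\leq\|Tx\|$ for all $x\in H$. *)

theory Defs
  imports "HOL-Analysis.Analysis"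
begin

text \<open>
  Complex Hilbert spaces. The underlying real Hilbert space, with inner product
  \<open>Re \<langle>x, y\<rangle>\<close>, is part of the class, so that the norm, the topology and completeness are those
  of the library: \<open>norm x = sqrt (inner x x) = sqrt (Re \<langle>x, x\<rangle>)\<close>. Positive definiteness of
  \<open>cinner\<close> is inherited from \<open>inner\<close>, since \<open>\<langle>x, x\<rangle>\<close> is real by \<open>cinner_commute\<close>. The complex
  inner product is linear in its first argument.
\<close>

class complex_hilbert_space = real_inner + complete_space +
  fixes scaleC :: "complex \<Rightarrow> 'a \<Rightarrow> 'a" (infixr \<open>*\<^sub>C\<close> 75)
    and cinner :: "'a \<Rightarrow> 'a \<Rightarrow> complex"
  assumes scaleC_add_right: "a *\<^sub>C (x + y) = a *\<^sub>C x + a *\<^sub>C y"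
    and scaleC_add_left: "(a + b) *\<^sub>C x = a *\<^sub>C x + b *\<^sub>C x"
    and scaleC_scaleC: "a *\<^sub>C (b *\<^sub>C x) = (a * b) *\<^sub>C x"
    and scaleC_one: "1 *\<^sub>C x = x"
    and scaleR_eq_scaleC: "r *\<^sub>R x = complex_of_real r *\<^sub>C x"
    and cinner_commute: "cinner x y = cnj (cinner y x)"
    and cinner_add_left: "cinner (x + y) z = cinner x z + cinner y z"
    and cinner_scaleC_left: "cinner (a *\<^sub>C x) y = a * cinner x y"
    and inner_eq_Re_cinner: "inner x y = Re (cinner x y)"

text \<open>
  \<open>B(H)\<close>: the type \<open>'a \<Rightarrow>\<^sub>L 'a\<close> consists of the bounded real-linear operators, hence the
  extra condition.
\<close>

definition BH :: "('a::complex_hilbert_space \<Rightarrow>\<^sub>L 'a) set" where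
  "BH = {T :: 'a \<Rightarrow>\<^sub>L 'a. \<forall>c x. T (c *\<^sub>C x) = c *\<^sub>C T x}"

definition cadjoint :: "('a::complex_hilbert_space \<Rightarrow>\<^sub>L 'a) \<Rightarrow> ('a \<Rightarrow>\<^sub>L 'a)" where
  "cadjoint T = (THE S. S \<in> BH \<and> (\<forall>x y. cinner (T x) y = cinner x (S y)))"

text \<open>Membership in \<open>\<real>\<^sub>\<ge>\<^sub>0\<close> includes that the complex number \<open>\<langle>T x, x\<rangle>\<close> is real.\<close>

definition positive_op :: "('a::complex_hilbert_space \<Rightarrow>\<^sub>L 'a) \<Rightarrow> bool" where
  "positive_op T \<longleftrightarrow> (\<forall>x. cinner (T x) x \<in> \<real>\<^sub>\<ge>\<^sub>0)"

definition op_le :: "('a::complex_hilbert_space \<Rightarrow>\<^sub>L 'a) \<Rightarrow> ('a \<Rightarrow>\<^sub>L 'a) \<Rightarrow> bool"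
    (infix \<open>\<preceq>\<close> 50) where
  "S \<preceq> T \<longleftrightarrow> positive_op (T - S)"

definition modulus :: "('a::complex_hilbert_space \<Rightarrow>\<^sub>L 'a) \<Rightarrow> ('a \<Rightarrow>\<^sub>L 'a)" where
  "modulus T = (THE P. P \<in> BH \<and> positive_op P \<and> P o\<^sub>L P = cadjoint T o\<^sub>L T)"

definition normal_op :: "('a::complex_hilbert_space \<Rightarrow>\<^sub>L 'a) \<Rightarrow> bool" where
  "normal_op T \<longleftrightarrow> T o\<^sub>L cadjoint T = cadjoint T o\<^sub>L T"

definition hyponormal_op :: "('a::complex_hilbert_space \<Rightarrow>\<^sub>L 'a) \<Rightarrow> bool" where
  "hyponormal_op T \<longleftrightarrow> T o\<^sub>L cadjoint T \<preceq> cadjoint T o\<^sub>L T"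

end

theory Submission
  imports Defs "HOL-Complex_Analysis.Cauchy_Integral_Formula"
begin

text \<open>
  Write \<open>P = |A|\<close> and \<open>Q = |B|\<close>. Everything reduces to one comparison principle for operators on a
  real inner product space (\<open>inner_le_psd_if_norm_le\<close>): if \<open>S\<close> is symmetric, \<open>P\<close> is positive and
  \<open>\<parallel>S x\<parallel> \<le> \<parallel>P x\<parallel>\<close> for all \<open>x\<close>, then \<open>S \<le> P\<close>. It contains both the monotonicity of the square root
  and the inequality \<open>Re T \<le> |T|\<close> for hyponormal \<open>T\<close>: indeed
  \<open>\<parallel>Re T x\<parallel> \<le> (\<parallel>T x\<parallel> + \<parallel>T\<^sup>* x\<parallel>) / 2 \<le> \<parallel>T x\<parallel> = \<parallel>|T| x\<parallel>\<close>.

  By Fuglede's theorem \<open>B\<close> also commutes with \<open>A\<^sup>*\<close>, hence with \<open>P\<close>, and \<open>P\<close> commutes with \<open>Q\<close>. Therefore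
  \<open>T = A\<^sup>* B\<close> is hyponormal with modulus \<open>P Q\<close>, which is positive as a product of commuting positive
  operators. The principle gives \<open>Re (A\<^sup>* B) \<le> P Q\<close>, that is
  \<open>Re \<langle>A x, B x\<rangle> \<le> Re \<langle>P x, Q x\<rangle>\<close> (\<open>inner_le_inner_modulus\<close>). Since \<open>\<parallel>P x\<parallel> = \<parallel>A x\<parallel>\<close> and
  \<open>\<parallel>Q x\<parallel> = \<parallel>B x\<parallel>\<close>, expanding the squares yields \<open>\<parallel>(P - Q) x\<parallel> \<le> \<parallel>(A - B) x\<parallel>\<close>, and the principle, now
  applied to the moduli of these two differences, turns this into the claim.

  Neither the spectral theorem nor a functional calculus is involved. Square roots are obtained
  from a norm-convergent iteration, and Fuglede's theorem from a variant of Rosenblum's argument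
  in which the exponentials are replaced by powers of Euler steps.
\<close>

section \<open>Adjoints in real Hilbert spaces\<close>

text \<open>The additional instance supplies the completeness of the space of bounded operators.\<close>

instance complex_hilbert_space \<subseteq> banach ..

text \<open>
  The representing vector is the minimizer of \<open>\<parallel>x\<parallel>\<^sup>2 - 2 f x\<close>. Minimizing sequences are Cauchy by
  the parallelogram law, and the first-order condition at the minimizer is the claim.
\<close>

lemma riesz_representation:
  fixes f :: "'a::{real_inner,complete_space} \<Rightarrow> real"
  assumes "bounded_linear f"
  obtains u where "\<And>x. f x = inner u x"
proof -
  interpret f: bounded_linear f by fact
  define J where "J x = (norm x)\<^sup>2 - 2 * f x" for x
  obtain K where K: "\<And>x. norm (f x) \<le> norm x * K"
    using f.bounded by blast
  have "- K\<^sup>2 \<le> J x" for x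
  proof -
    have "0 \<le> (norm x - K)\<^sup>2" by simp
    also have "\<dots> = (norm x)\<^sup>2 - 2 * (norm x * K) + K\<^sup>2"
      by (simp add: power2_diff)
    finally show ?thesis
      using K[of x] by (auto simp: J_def)
  qed
  then have bdd: "bdd_below (range J)" by (rule bdd_belowI2)
  define m where "m = Inf (range J)"
  have m: "m \<le> J x" for x
    unfolding m_def using bdd by (simp add: cInf_lower)
  have "\<exists>x. J x < m + 1 / Suc n" for n
    using cInf_lessD[of "range J" "m + 1 / Suc n"] by (auto simp: m_def)
  then obtain X where X: "\<And>n. J (X n) < m + 1 / Suc n" by metis
  have par: "(norm (x - y))\<^sup>2 \<le> 2 * (J x - m) + 2 * (J y - m)" for x y
  proof -
    have "(norm (x - y))\<^sup>2 = 2 * J x + 2 * J y - 4 * J ((1/2) *\<^sub>R (x + y))"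
      by (simp add: J_def f.add f.scaleR power2_norm_eq_inner inner_simps inner_commute
          field_simps)
    with m[of "(1/2) *\<^sub>R (x + y)"] show ?thesis by simp
  qed
  have "Cauchy X"
  proof (rule CauchyI)
    fix e :: real assume "0 < e"
    then obtain N where N: "1 / Suc N < e\<^sup>2 / 4"
      using nat_approx_posE[of "e\<^sup>2 / 4"] by auto
    show "\<exists>M. \<forall>k\<ge>M. \<forall>n\<ge>M. norm (X k - X n) < e"
    proof (intro exI allI impI)
      fix k n assume "N \<le> k" "N \<le> n"
      then have "1 / Suc k \<le> 1 / Suc N" "1 / Suc n \<le> 1 / Suc N"
        by (auto intro!: divide_left_mono)
      then have "J (X k) - m < e\<^sup>2 / 4" "J (X n) - m < e\<^sup>2 / 4"
        using X[of k] X[of n] N by linarith+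
      then have "2 * (J (X k) - m) + 2 * (J (X n) - m) < 2 * (e\<^sup>2 / 4) + 2 * (e\<^sup>2 / 4)"
        by (intro add_strict_mono mult_strict_left_mono) auto
      with par[of "X k" "X n"] have "(norm (X k - X n))\<^sup>2 < e\<^sup>2" by simp
      then show "norm (X k - X n) < e"
        by (rule power2_less_imp_less) (use \<open>0 < e\<close> in simp)
    qed
  qed
  then obtain u where u: "X \<longlonglongrightarrow> u"
    using Cauchy_convergent convergent_def by blast
  have "(\<lambda>n. J (X n)) \<longlonglongrightarrow> J u"
    unfolding J_def by (intro tendsto_intros u f.tendsto)
  moreover have "(\<lambda>n. m + 1 / Suc n) \<longlonglongrightarrow> m + 0"
    by (intro tendsto_intros LIMSEQ_Suc[OF lim_1_over_n])
  ultimately have "J u \<le> m + 0"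
    using X by (intro LIMSEQ_le) (auto intro: less_imp_le)
  then have min: "J u \<le> J v" for v using m[of v] by simp
  have "f v = inner u v" for v
  proof (rule ccontr)
    define d where "d = inner u v - f v"
    assume "f v \<noteq> inner u v"
    then have d: "d \<noteq> 0" by (simp add: d_def)
    have v: "0 \<le> t\<^sup>2 * (norm v)\<^sup>2 + 2 * t * d" for t
      using min[of "u + t *\<^sub>R v"] unfolding J_def d_def power2_norm_eq_inner
      by (simp add: f.add f.scaleR inner_simps inner_commute
          power2_eq_square algebra_simps)
    \<comment> \<open>The choice \<open>t = - d / n\<close> makes the linear term dominate; adding 1 avoids a division by zero
      when \<open>v = 0\<close>.\<close>
    define n where "n = (norm v)\<^sup>2 + 1"
    have n: "0 < n" "(norm v)\<^sup>2 < n" by (auto simp: n_def add_nonneg_pos)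
    have "(d / n)\<^sup>2 * (norm v)\<^sup>2 \<le> (d / n)\<^sup>2 * n"
      using n by (intro mult_left_mono) auto
    also have "\<dots> = d\<^sup>2 / n" using n by (simp add: power2_eq_square)
    finally have "0 \<le> d\<^sup>2 / n - 2 * (d\<^sup>2 / n)"
      using v[of "- d / n"] by (simp add: power2_eq_square)
    moreover have "0 < d\<^sup>2 / n" using d n by simp
    ultimately show False by linarith
  qed
  then show ?thesis by (rule that)
qed

lemma blinfun_adjoint_exists:
  fixes T :: "'a::{real_inner,complete_space} \<Rightarrow>\<^sub>L 'a"
  obtains S :: "'a \<Rightarrow>\<^sub>L 'a" where "\<And>x y. inner (T x) y = inner x (S y)"
proof -
  have "\<exists>u. \<forall>x. inner (T x) y = inner x u" for y
  proof -
    have "bounded_linear (\<lambda>x. inner (T x) y)"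
      by (intro bounded_linear_inner_left_comp blinfun.bounded_linear_right)
    then obtain u where "\<And>x. inner (T x) y = inner u x"
      using riesz_representation by blast
    then show ?thesis by (auto simp: inner_commute)
  qed
  then obtain S where S: "\<And>x y. inner (T x) y = inner x (S y)" by metis
  have "bounded_linear S"
  proof (rule bounded_linear_intro)
    show "S (x + y) = S x + S y" for x y
      by (rule vector_eq_ldot[THEN iffD1]) (simp add: S[symmetric] inner_add_right)
    show "S (r *\<^sub>R x) = r *\<^sub>R S x" for r x
      by (rule vector_eq_ldot[THEN iffD1]) (simp add: S[symmetric])
    show "norm (S y) \<le> norm y * norm T" for y
    proof (cases "S y = 0")
      case False
      have "norm (S y) * norm (S y) = inner (T (S y)) y"
        by (simp add: S norm_eq_sqrt_inner)
      also have "\<dots> \<le> norm (T (S y)) * norm y" by (rule norm_cauchy_schwarz)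
      also have "\<dots> \<le> norm T * norm (S y) * norm y"
        by (intro mult_right_mono norm_blinfun) auto
      finally show ?thesis using False by (simp add: mult_ac)
    qed simp
  qed
  then have "blinfun_apply (Blinfun S) = S" by (rule bounded_linear_Blinfun_apply)
  with S show ?thesis using that[of "Blinfun S"] by simp
qed

section \<open>Positive operators and the comparison principle\<close>

text \<open>
  Positivity for the underlying real inner product. Symmetry has to be demanded here, since over the
  reals it does not follow from the sign of the quadratic form. Working with the real structure
  keeps the comparison principle and the square root free of complex scalars.
\<close>

definition psd :: "('a::real_inner \<Rightarrow>\<^sub>L 'a) \<Rightarrow> bool" where
  "psd T \<longleftrightarrow> (\<forall>x y. inner (T x) y = inner x (T y)) \<and> (\<forall>x. 0 \<le> inner (T x) x)"

lemma psd_symmetric: "psd T \<Longrightarrow> inner (T x) y = inner x (T y)"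
  by (simp add: psd_def)

lemma psd_nonneg: "psd T \<Longrightarrow> 0 \<le> inner (T x) x"
  unfolding psd_def by blast

text \<open>
  The form of \<open>T\<close> is nonnegative at \<open>x - T x / c\<close>, which is the gradient step of length \<open>1 / c\<close>
  from \<open>x\<close>. The estimate makes approximate zeros of the form approximate zeros of \<open>T\<close>.
\<close>

lemma norm_sq_le_inner_psd:
  assumes "psd T" "norm T \<le> c" "0 < c"
  shows "(norm (T x))\<^sup>2 \<le> c * inner (T x) x"
proof -
  have sym: "inner (T x) y = inner x (T y)"
    and nonneg: "0 \<le> inner (T x) x" for x y
    using assms(1) by (auto simp: psd_def)
  let ?u = "x - (1 / c) *\<^sub>R T x"
  have "inner (T (T x)) (T x) \<le> norm (T (T x)) * norm (T x)"
    by (rule norm_cauchy_schwarz)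
  also have "\<dots> \<le> (c * norm (T x)) * norm (T x)"
    using norm_blinfun[of T "T x"] assms(2)
    by (meson dual_order.trans mult_right_mono norm_ge_zero)
  finally have 1: "inner (T (T x)) (T x) \<le> c * (norm (T x))\<^sup>2"
    by (simp add: power2_eq_square)
  have "0 \<le> inner (T ?u) ?u" by (rule nonneg)
  also have "\<dots> = inner (T x) x - 2 / c * (norm (T x))\<^sup>2 + inner (T (T x)) (T x) / c\<^sup>2"
    unfolding power2_norm_eq_inner
    using sym[of "T x" x]
    by (simp add: blinfun.diff_right blinfun.scaleR_right inner_simps
        inner_commute power2_eq_square diff_divide_distrib)
  also have "\<dots> \<le> inner (T x) x - 2 / c * (norm (T x))\<^sup>2 + c * (norm (T x))\<^sup>2 / c\<^sup>2"
    using 1 by (simp add: divide_right_mono)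
  also have "\<dots> = inner (T x) x - (norm (T x))\<^sup>2 / c"
    using assms(3) by (simp add: power2_eq_square field_simps)
  finally show ?thesis using assms(3) by (simp add: field_simps)
qed

text \<open>
  Let \<open>\<mu> \<ge> 0\<close> be minimal with \<open>P - S + \<mu> \<ge> 0\<close>, and suppose \<open>\<mu> > 0\<close>. An approximate minimizer \<open>x\<close> of the
  form of \<open>P - S\<close> on the unit sphere is an approximate eigenvector, so \<open>S x\<close> is close to \<open>P x + \<mu> x\<close>. Because \<open>P\<close> is positive,
  \<open>\<parallel>P x + \<mu> x\<parallel>\<^sup>2 \<ge> \<parallel>P x\<parallel>\<^sup>2 + \<mu>\<^sup>2 \<parallel>x\<parallel>\<^sup>2\<close>, which contradicts \<open>\<parallel>S x\<parallel> \<le> \<parallel>P x\<parallel>\<close>. In quantitative form: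
  \<open>T = P - S + \<mu>\<close> satisfies \<open>\<parallel>T x\<parallel> \<ge> k \<parallel>x\<parallel>\<close> for some \<open>k > 0\<close>, so by \<open>norm_sq_le_inner_psd\<close> its form is at
  least \<open>k\<^sup>2 \<parallel>x\<parallel>\<^sup>2 / c\<close>, and \<open>\<mu>\<close> could be decreased.
\<close>

lemma inner_le_psd_if_norm_le:
  fixes S P :: "'a::real_inner \<Rightarrow>\<^sub>L 'a"
  assumes S: "\<And>x y. inner (S x) y = inner x (S y)"
    and P: "psd P"
    and le: "\<And>x. norm (S x) \<le> norm (P x)"
  shows "inner (S x) x \<le> inner (P x) x"
proof -
  define D where "D = P - S"
  define M where "M = {\<mu>. 0 \<le> \<mu> \<and> (\<forall>x. 0 \<le> inner (D x) x + \<mu> * (norm x)\<^sup>2)}"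
  have "norm D \<in> M"
  proof -
    have "\<bar>inner (D x) x\<bar> \<le> norm D * (norm x)\<^sup>2" for x
      using Cauchy_Schwarz_ineq2[of "D x" x] norm_blinfun[of D x]
      by (smt (verit) mult.assoc mult_right_mono norm_ge_zero power2_eq_square)
    then have "0 \<le> inner (D x) x + norm D * (norm x)\<^sup>2" for x
      by (smt (verit))
    then show ?thesis by (simp add: M_def)
  qed
  then have ne: "M \<noteq> {}" by auto
  have bdd: "bdd_below M" by (auto simp: M_def intro: bdd_belowI[of _ 0])
  define \<mu> where "\<mu> = Inf M"
  have "closed M"
  proof -
    have "M = {0..} \<inter> (\<Inter>x. {\<mu>. 0 \<le> inner (D x) x + \<mu> * (norm x)\<^sup>2})"
      by (auto simp: M_def)
    also have "closed \<dots>"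
      by (intro closed_Int closed_INT closed_atLeast ballI closed_Collect_le continuous_intros)
    finally show ?thesis .
  qed
  then have \<mu>: "\<mu> \<in> M" unfolding \<mu>_def by (rule closed_contains_Inf[OF ne bdd])
  have "\<mu> = 0"
  proof (rule ccontr)
    assume "\<mu> \<noteq> 0"
    with \<mu> have pos: "0 < \<mu>" by (auto simp: M_def)
    define T where "T = D + \<mu> *\<^sub>R id_blinfun"
    have T_apply: "T x = P x - S x + \<mu> *\<^sub>R x" for x
      by (simp add: T_def D_def blinfun.add_left blinfun.diff_left blinfun.scaleR_left)
    have "psd T"
      using \<mu> P S unfolding psd_def T_apply M_def D_def
      by (simp add: inner_simps blinfun.diff_left power2_norm_eq_inner)
    define p where "p = norm P"
    \<comment> \<open>Chosen such that \<open>k < 1\<close> and \<open>2 p k + k\<^sup>2 < \<mu>\<^sup>2\<close>.\<close>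
    define k where "k = \<mu>\<^sup>2 / (2 * p + 1 + \<mu>\<^sup>2)"
    have p0: "0 \<le> p" by (simp add: p_def)
    have den: "0 < 2 * p + 1 + \<mu>\<^sup>2" using p0 by (simp add: add_pos_nonneg)
    have k: "0 < k" "k < 1" "(2 * p + 1) * k < \<mu>\<^sup>2"
      using den pos p0 by (auto simp: k_def field_simps)
    have lower: "k * norm x \<le> norm (T x)" for x
    proof (rule ccontr)
      assume "\<not> ?thesis"
      then have e: "norm (T x) < k * norm x" by simp
      then have x: "0 < norm x" by (cases "x = 0") auto
      have "norm (P x + \<mu> *\<^sub>R x) = norm (S x + T x)" by (simp add: T_apply)
      also have "\<dots> \<le> norm (P x) + norm (T x)"
        using norm_triangle_ineq[of "S x" "T x"] le[of x] by simp
      finally have "(norm (P x + \<mu> *\<^sub>R x))\<^sup>2 \<le> (norm (P x) + norm (T x))\<^sup>2"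
        by (intro power_mono) auto
      moreover have "(norm (P x + \<mu> *\<^sub>R x))\<^sup>2
          = (norm (P x))\<^sup>2 + 2 * \<mu> * inner (P x) x + \<mu>\<^sup>2 * (norm x)\<^sup>2"
        unfolding power2_norm_eq_inner
        by (simp add: inner_simps inner_commute power2_eq_square algebra_simps)
      moreover have "0 \<le> \<mu> * inner (P x) x" using P pos unfolding psd_def by (intro mult_nonneg_nonneg) auto
      ultimately have "\<mu>\<^sup>2 * (norm x)\<^sup>2 \<le> 2 * norm (P x) * norm (T x) + (norm (T x))\<^sup>2"
        by (simp add: power2_sum)
      also have "\<dots> \<le> 2 * (p * norm x) * (k * norm x) + (k * norm x)\<^sup>2"
        using e k p0 norm_blinfun[of P x]
        by (intro add_mono mult_mono power_mono) (auto simp: p_def)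
      also have "\<dots> = (2 * p * k + k * k) * (norm x)\<^sup>2"
        by (simp add: power2_eq_square algebra_simps)
      also have "\<dots> \<le> ((2 * p + 1) * k) * (norm x)\<^sup>2"
        using k by (intro mult_right_mono) (auto simp: algebra_simps)
      also have "\<dots> < \<mu>\<^sup>2 * (norm x)\<^sup>2"
        using k x by (intro mult_strict_right_mono) auto
      finally show False by simp
    qed
    define c where "c = norm T + 1"
    have c: "0 < c" "norm T \<le> c" by (auto simp: c_def add_nonneg_pos)
    define \<mu>' where "\<mu>' = max 0 (\<mu> - k\<^sup>2 / c)"
    have "0 \<le> inner (D x) x + \<mu>' * (norm x)\<^sup>2" for x
    proof -
      have "(k * norm x)\<^sup>2 \<le> (norm (T x))\<^sup>2"
        using lower[of x] k by (intro power_mono) auto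
      also have "\<dots> \<le> c * inner (T x) x"
        by (rule norm_sq_le_inner_psd) fact+
      also have "inner (T x) x = inner (D x) x + \<mu> * (norm x)\<^sup>2"
        by (simp add: T_def blinfun.add_left blinfun.scaleR_left inner_simps
            power2_norm_eq_inner)
      finally have "k\<^sup>2 / c * (norm x)\<^sup>2 \<le> inner (D x) x + \<mu> * (norm x)\<^sup>2"
        using c by (simp add: field_simps power_mult_distrib)
      then have "0 \<le> inner (D x) x + (\<mu> - k\<^sup>2 / c) * (norm x)\<^sup>2"
        by (simp add: algebra_simps)
      also have "\<dots> \<le> inner (D x) x + \<mu>' * (norm x)\<^sup>2"
        by (intro add_left_mono mult_right_mono) (auto simp: \<mu>'_def)
      finally show ?thesis .
    qed
    then have "\<mu>' \<in> M" by (simp add: M_def \<mu>'_def)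
    then have "\<mu> \<le> \<mu>'" unfolding \<mu>_def using bdd by (rule cInf_lower)
    moreover have "0 < k\<^sup>2 / c" using k c by simp
    ultimately show False using pos by (simp add: \<mu>'_def max_def split: if_splits)
  qed
  with \<mu> have "0 \<le> inner (D x) x" by (auto simp: M_def)
  then show ?thesis by (simp add: D_def blinfun.diff_left inner_simps)
qed

text \<open>
  Two positive square roots satisfy \<open>\<parallel>P x\<parallel> = \<parallel>Q x\<parallel>\<close>, so the comparison principle in both directions
  gives equal quadratic forms; polarization gives equal operators.
\<close>

lemma psd_sqrt_unique:
  assumes P: "psd P" and Q: "psd Q" and eq: "P o\<^sub>L P = Q o\<^sub>L Q"
  shows "P = Q"
proof -
  have sq: "(norm (R x))\<^sup>2 = inner x ((R o\<^sub>L R) x)" if "psd R" for R :: "'a \<Rightarrow>\<^sub>L 'a" and x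
    using that by (simp add: psd_def power2_norm_eq_inner)
  have nrm: "norm (P x) = norm (Q x)" for x
    using sq[OF P, of x] sq[OF Q, of x] eq by (metis norm_ge_zero power2_eq_iff_nonneg)
  have le: "inner (P x) x = inner (Q x) x" for x
    by (intro antisym inner_le_psd_if_norm_le P Q) (use P Q nrm in \<open>auto simp: psd_def\<close>)
  have "P x = Q x" for x
  proof -
    have P': "inner (P x) y = inner (P y) x" and Q': "inner (Q x) y = inner (Q y) x" for x y
      using P Q unfolding psd_def by (metis inner_commute)+
    let ?d = "P x - Q x"
    have "inner (P x) ?d = inner (Q x) ?d"
      using le[of "x + ?d"] le[of x] le[of ?d] P'[of x ?d] Q'[of x ?d]
      by (simp add: blinfun.add_right inner_add_left inner_add_right)
    then have "inner ?d ?d = 0" by (simp add: inner_diff_left)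
    then show ?thesis by simp
  qed
  then show ?thesis by (rule blinfun_eqI)
qed

section \<open>The positive square root\<close>

text \<open>
  With \<open>X = 1 - P\<close>, the operator \<open>1 - L\<close> is a square root of \<open>P\<close> if and only if
  \<open>L = (X + L\<^sup>2) / 2\<close>. The iteration of this equation from \<open>0\<close> is dominated, increment by increment,
  by the scalar iteration \<open>y \<mapsto> (1 + y\<^sup>2) / 2\<close>. The latter increases and stays below 1, so the
  operator iteration converges in norm. Its terms are polynomials in \<open>X\<close>, whence the statement on
  the commutant.
\<close>

lemma psd_sqrt_exists_contraction:
  fixes P :: "'a::{real_inner,banach} \<Rightarrow>\<^sub>L 'a"
  assumes P: "psd P" and le: "norm P \<le> 1"
  obtains R where "psd R" "R o\<^sub>L R = P" "\<And>C. C o\<^sub>L P = P o\<^sub>L C \<Longrightarrow> C o\<^sub>L R = R o\<^sub>L C"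
proof -
  interpret comp: bounded_bilinear "blinfun_compose :: ('a \<Rightarrow>\<^sub>L 'a) \<Rightarrow> ('a \<Rightarrow>\<^sub>L 'a) \<Rightarrow> ('a \<Rightarrow>\<^sub>L 'a)"
    by (rule bounded_bilinear_blinfun_compose)
  define X where "X = id_blinfun - P"
  have symX: "inner (X x) y = inner x (X y)" for x y
    using P by (simp add: X_def psd_def blinfun.diff_left inner_simps)
  have normX: "norm X \<le> 1"
  proof (rule norm_blinfun_bound)
    fix x
    have "(norm (X x))\<^sup>2 = (norm x)\<^sup>2 - 2 * inner (P x) x + (norm (P x))\<^sup>2"
      unfolding power2_norm_eq_inner X_def
      by (simp add: blinfun.diff_left inner_simps inner_commute)
    also have "\<dots> \<le> (norm x)\<^sup>2"
      using norm_sq_le_inner_psd[OF P le, of x] psd_nonneg[OF P, of x] by simp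
    finally have "norm (X x) \<le> norm x"
      by (rule power2_le_imp_le) simp
    then show "norm (X x) \<le> 1 * norm x" by simp
  qed simp
  define Y where "Y = rec_nat 0 (\<lambda>_ T. (1/2) *\<^sub>R (X + (T o\<^sub>L T)))"
  have Y_simps [simp]: "Y 0 = 0" "Y (Suc n) = (1/2) *\<^sub>R (X + (Y n o\<^sub>L Y n))" for n
    by (simp_all add: Y_def)
  define y :: "nat \<Rightarrow> real" where "y = rec_nat 0 (\<lambda>_ t. (1 + t * t) / 2)"
  have y_simps [simp]: "y 0 = 0" "y (Suc n) = (1 + y n * y n) / 2" for n
    by (simp_all add: y_def)
  have y_bd: "0 \<le> y n \<and> y n \<le> 1" for n
  proof (induction n)
    case (Suc n)
    then have "y n * y n \<le> 1" by (simp add: mult_le_one)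
    with Suc show ?case by simp
  qed simp
  have Y_le: "norm (Y n) \<le> y n" for n
  proof (induction n)
    case (Suc n)
    have "norm (Y n o\<^sub>L Y n) \<le> y n * y n"
      using norm_blinfun_compose[of "Y n" "Y n"] mult_mono[OF Suc Suc] y_bd[of n] by simp
    then show ?case
      using normX norm_triangle_ineq[of X "Y n o\<^sub>L Y n"] by simp
  qed simp
  have increment: "norm (Y (Suc n) - Y n) \<le> y (Suc n) - y n" for n
  proof (induction n)
    case 0
    then show ?case using normX by simp
  next
    case (Suc n)
    let ?D = "Y (Suc n) - Y n"
    have "Y (Suc (Suc n)) - Y (Suc n)
        = (1/2) *\<^sub>R ((Y (Suc n) o\<^sub>L Y (Suc n)) - (Y n o\<^sub>L Y n))"
      by (simp only: Y_simps scaleR_diff_right[symmetric]) (simp add: algebra_simps)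
    \<comment> \<open>This form of the difference of two squares is valid without commutativity.\<close>
    also have "\<dots> = (1/2) *\<^sub>R ((Y (Suc n) o\<^sub>L ?D) + (?D o\<^sub>L Y n))"
      by (simp add: comp.diff_left comp.diff_right del: Y_simps)
    also have "norm \<dots> \<le> (1/2) * (norm (Y (Suc n)) * norm ?D + norm ?D * norm (Y n))"
      using norm_triangle_ineq[of "Y (Suc n) o\<^sub>L ?D" "?D o\<^sub>L Y n"]
        norm_blinfun_compose[of "Y (Suc n)" ?D] norm_blinfun_compose[of ?D "Y n"]
      by (simp del: Y_simps)
    also have "\<dots> \<le> (1/2) * (y (Suc n) * (y (Suc n) - y n) + (y (Suc n) - y n) * y n)"
      using Suc Y_le[of "Suc n"] Y_le[of n] y_bd[of n] y_bd[of "Suc n"]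
        order_trans[OF norm_ge_zero Suc]
      by (intro mult_left_mono add_mono mult_mono) (simp_all del: Y_simps y_simps)
    also have "\<dots> = y (Suc (Suc n)) - y (Suc n)"
      by (simp only: y_simps(2)[of "Suc n"]) (simp add: field_simps)
    finally show ?case .
  qed
  have inc: "incseq y"
    by (rule incseq_SucI) (use increment in \<open>meson norm_ge_zero order_trans diff_ge_0_iff_ge\<close>)
  have diff: "norm (Y m - Y n) \<le> y m - y n" if "n \<le> m" for m n
    using that
  proof (induction m rule: dec_induct)
    case (step m)
    have "norm (Y (Suc m) - Y n) \<le> norm (Y (Suc m) - Y m) + norm (Y m - Y n)"
      using norm_triangle_ineq[of "Y (Suc m) - Y m" "Y m - Y n"] by simp
    also have "\<dots> \<le> (y (Suc m) - y m) + (y m - y n)"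
      by (intro add_mono step.IH increment)
    finally show ?case by simp
  qed simp
  obtain l where "y \<longlonglongrightarrow> l"
    using incseq_convergent[OF inc, of 1] y_bd by metis
  then have "Cauchy y" by (rule LIMSEQ_imp_Cauchy)
  have "Cauchy Y"
  proof (rule CauchyI')
    fix e :: real assume "0 < e"
    with \<open>Cauchy y\<close> obtain N where N: "\<And>m n. N \<le> m \<Longrightarrow> N \<le> n \<Longrightarrow> norm (y m - y n) < e"
      using CauchyD by metis
    have "dist (Y m) (Y n) < e" if "N \<le> m" "m < n" for m n
      using diff[of m n] N[of n m] that by (simp add: dist_norm norm_minus_commute)
    then show "\<exists>M. \<forall>m\<ge>M. \<forall>n>m. dist (Y m) (Y n) < e" by blast
  qed
  then obtain L where L: "Y \<longlonglongrightarrow> L"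
    using Cauchy_convergent convergent_def by blast
  have "(\<lambda>n. Y (Suc n)) \<longlonglongrightarrow> (1/2) *\<^sub>R (X + (L o\<^sub>L L))"
    unfolding Y_simps by (intro tendsto_intros comp.tendsto L)
  then have fixpoint: "L = (1/2) *\<^sub>R (X + (L o\<^sub>L L))"
    using LIMSEQ_unique LIMSEQ_Suc[OF L] by blast
  have "norm L \<le> 1"
    by (rule LIMSEQ_le_const2[OF tendsto_norm[OF L]]) (meson Y_le y_bd order_trans)
  have symY: "inner (Y n x) z = inner x (Y n z)" for n x z
    by (induction n arbitrary: x z)
      (simp_all add: blinfun.scaleR_left blinfun.add_left inner_add_left inner_add_right symX)
  have app: "(\<lambda>n. Y n x) \<longlonglongrightarrow> L x" for x
    by (intro blinfun.tendsto L tendsto_const)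
  have symL: "inner (L x) z = inner x (L z)" for x z
  proof (rule LIMSEQ_unique)
    show "(\<lambda>n. inner (Y n x) z) \<longlonglongrightarrow> inner (L x) z"
      by (intro tendsto_intros app)
    show "(\<lambda>n. inner (Y n x) z) \<longlonglongrightarrow> inner x (L z)"
      unfolding symY by (intro tendsto_intros app)
  qed
  define R where "R = id_blinfun - L"
  have "psd R"
    unfolding psd_def
  proof (intro conjI allI)
    show "inner (R x) z = inner x (R z)" for x z
      by (simp add: R_def blinfun.diff_left inner_simps symL)
    show "0 \<le> inner (R x) x" for x
    proof -
      have "inner (L x) x \<le> norm (L x) * norm x" by (rule norm_cauchy_schwarz)
      also have "\<dots> \<le> 1 * norm x * norm x"
        using order_trans[OF norm_blinfun[of L x] mult_right_mono[OF \<open>norm L \<le> 1\<close> norm_ge_zero]]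
        by (intro mult_right_mono) auto
      finally show ?thesis
        by (simp add: R_def blinfun.diff_left inner_diff_left dot_square_norm power2_eq_square)
    qed
  qed
  moreover have "R o\<^sub>L R = P"
  proof -
    have "R o\<^sub>L R = id_blinfun - 2 *\<^sub>R L + (L o\<^sub>L L)"
      by (rule blinfun_eqI)
        (simp add: R_def blinfun.diff_left blinfun.diff_right blinfun.add_left
          blinfun.scaleR_left scaleR_2 algebra_simps)
    also have "2 *\<^sub>R L = X + (L o\<^sub>L L)"
      by (subst fixpoint) simp
    finally show ?thesis by (simp add: X_def)
  qed
  moreover have "C o\<^sub>L R = R o\<^sub>L C" if C: "C o\<^sub>L P = P o\<^sub>L C" for C
  proof -
    have CP: "C (P x) = P (C x)" for x
      using arg_cong[OF C, of "\<lambda>T. blinfun_apply T x"] by simp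
    have CX: "C (X x) = X (C x)" for x
      by (simp add: X_def blinfun.diff_left blinfun.diff_right CP)
    have "C o\<^sub>L Y n = Y n o\<^sub>L C" for n
    proof -
      have "C (Y n x) = Y n (C x)" for x
        by (induction n arbitrary: x)
          (simp_all add: blinfun.scaleR_left blinfun.scaleR_right blinfun.add_left
            blinfun.add_right CX)
      then show ?thesis by (auto intro: blinfun_eqI)
    qed
    then have "(\<lambda>n. C o\<^sub>L Y n) \<longlonglongrightarrow> (L o\<^sub>L C)"
      by (auto intro!: comp.tendsto L)
    moreover have "(\<lambda>n. C o\<^sub>L Y n) \<longlonglongrightarrow> (C o\<^sub>L L)"
      by (intro comp.tendsto L tendsto_const)
    ultimately have CL: "C o\<^sub>L L = L o\<^sub>L C"
      using LIMSEQ_unique by blast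
    have "C (L x) = L (C x)" for x
      using arg_cong[OF CL, of "\<lambda>T. blinfun_apply T x"] by simp
    then show ?thesis
      by (intro blinfun_eqI) (simp add: R_def blinfun.diff_left blinfun.diff_right)
  qed
  ultimately show ?thesis by (rule that)
qed

lemma psd_sqrt_exists:
  fixes P :: "'a::{real_inner,banach} \<Rightarrow>\<^sub>L 'a"
  assumes P: "psd P"
  obtains R where "psd R" "R o\<^sub>L R = P" "\<And>C. C o\<^sub>L P = P o\<^sub>L C \<Longrightarrow> C o\<^sub>L R = R o\<^sub>L C"
proof -
  interpret comp: bounded_bilinear "blinfun_compose :: ('a \<Rightarrow>\<^sub>L 'a) \<Rightarrow> ('a \<Rightarrow>\<^sub>L 'a) \<Rightarrow> ('a \<Rightarrow>\<^sub>L 'a)"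
    by (rule bounded_bilinear_blinfun_compose)
  define r where "r = norm P + 1"
  have r: "0 < r" "norm P \<le> r" by (auto simp: r_def add_nonneg_pos)
  let ?Q = "(1 / r) *\<^sub>R P"
  have "psd ?Q" "norm ?Q \<le> 1"
    using P r by (auto simp: psd_def blinfun.scaleR_left)
  then obtain R where R: "psd R" "R o\<^sub>L R = ?Q"
      "\<And>C. C o\<^sub>L ?Q = ?Q o\<^sub>L C \<Longrightarrow> C o\<^sub>L R = R o\<^sub>L C"
    using psd_sqrt_exists_contraction by blast
  show ?thesis
  proof (rule that)
    show "psd (sqrt r *\<^sub>R R)"
      using R(1) r by (auto simp: psd_def blinfun.scaleR_left)
    show "(sqrt r *\<^sub>R R) o\<^sub>L (sqrt r *\<^sub>R R) = P"
      using R(2) r by (simp add: comp.scaleR_left comp.scaleR_right)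
    show "C o\<^sub>L (sqrt r *\<^sub>R R) = (sqrt r *\<^sub>R R) o\<^sub>L C" if "C o\<^sub>L P = P o\<^sub>L C" for C
      using R(3)[of C] that by (simp add: comp.scaleR_left comp.scaleR_right)
  qed
qed

text \<open>
  With a square root \<open>R\<close> of \<open>P\<close>, which also commutes with \<open>Q\<close>, one has \<open>P Q = R Q R\<close>.
\<close>

lemma psd_compose_commuting:
  fixes P Q :: "'a::{real_inner,banach} \<Rightarrow>\<^sub>L 'a"
  assumes P: "psd P" and Q: "psd Q" and comm: "P o\<^sub>L Q = Q o\<^sub>L P"
  shows "psd (P o\<^sub>L Q)"
proof -
  obtain R where R: "psd R" "R o\<^sub>L R = P" and RQ: "Q o\<^sub>L R = R o\<^sub>L Q"
    using psd_sqrt_exists[OF P] comm by metis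
  have c: "P (Q x) = Q (P x)" "Q (R x) = R (Q x)" "P x = R (R x)" for x
    using arg_cong[OF comm, of "\<lambda>T. blinfun_apply T x"] R(2)
      arg_cong[OF RQ, of "\<lambda>T. blinfun_apply T x"] by auto
  show ?thesis
    unfolding psd_def
  proof (intro conjI allI)
    show "inner ((P o\<^sub>L Q) x) y = inner x ((P o\<^sub>L Q) y)" for x y
      using P Q c(1)[of y] by (simp add: psd_def)
    have "inner (P (Q x)) x = inner (Q (R x)) (R x)" for x
      using R(1) by (simp add: psd_def c(2,3))
    then show "0 \<le> inner ((P o\<^sub>L Q) x) x" for x
      using psd_nonneg[OF Q] by simp
  qed
qed

section \<open>Complex Hilbert spaces\<close>

lemma cinner_scaleC_right:
  fixes x y :: "'a::complex_hilbert_space"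
  shows "cinner x (c *\<^sub>C y) = cnj c * cinner x y"
  by (metis cinner_commute cinner_scaleC_left complex_cnj_mult)

lemma cinner_add_right:
  fixes x y z :: "'a::complex_hilbert_space"
  shows "cinner x (y + z) = cinner x y + cinner x z"
  by (metis cinner_commute cinner_add_left complex_cnj_add)

lemma inner_scaleC_left:
  fixes x y :: "'a::complex_hilbert_space"
  shows "inner (c *\<^sub>C x) y = inner x (cnj c *\<^sub>C y)"
  by (simp add: inner_eq_Re_cinner cinner_scaleC_left cinner_scaleC_right)

lemma cinner_eq_inner:
  fixes x y :: "'a::complex_hilbert_space"
  shows "cinner x y = Complex (inner x y) (inner x (\<i> *\<^sub>C y))"
  by (simp add: complex_eq_iff inner_eq_Re_cinner cinner_scaleC_right)

lemma norm_scaleC: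
  fixes x :: "'a::complex_hilbert_space"
  shows "norm (c *\<^sub>C x) = cmod c * norm x"
proof -
  have "inner (c *\<^sub>C x) (c *\<^sub>C x) = (cmod c)\<^sup>2 * inner x x"
    unfolding cmod_power2
    by (simp add: inner_eq_Re_cinner cinner_scaleC_left cinner_scaleC_right
        power2_eq_square algebra_simps)
  then show ?thesis
    by (simp add: norm_eq_sqrt_inner real_sqrt_mult)
qed

text \<open>
  After multiplication of \<open>x\<close> by \<open>cnj \<langle>x, y\<rangle>\<close> the inner product is real and nonnegative, and the real
  Cauchy--Schwarz inequality applies.
\<close>

lemma norm_cinner_le:
  fixes x y :: "'a::complex_hilbert_space"
  shows "cmod (cinner x y) \<le> norm x * norm y"
proof (cases "cinner x y = 0")
  case False
  let ?w = "cinner x y"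
  have "cmod ?w * cmod ?w = inner (cnj ?w *\<^sub>C x) y"
    unfolding power2_eq_square[symmetric] cmod_power2
    by (simp add: inner_eq_Re_cinner cinner_scaleC_left power2_eq_square)
  also have "\<dots> \<le> cmod ?w * (norm x * norm y)"
    using norm_cauchy_schwarz[of "cnj ?w *\<^sub>C x" y] by (simp add: norm_scaleC mult.assoc)
  finally show ?thesis using False by simp
qed simp

lemma bounded_linear_scaleC: "bounded_linear (\<lambda>x::'a::complex_hilbert_space. c *\<^sub>C x)"
proof (rule bounded_linear_intro)
  show "c *\<^sub>C (r *\<^sub>R x) = r *\<^sub>R c *\<^sub>C x" for r and x :: 'a
    by (simp add: scaleR_eq_scaleC scaleC_scaleC mult.commute)
  show "norm (c *\<^sub>C x) \<le> norm x * cmod c" for x :: 'a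
    by (simp add: norm_scaleC)
qed (rule scaleC_add_right)

lemmas scaleC_diff_right = bounded_linear.linear[OF bounded_linear_scaleC, THEN linear_diff]

lemma BH_scaleC: "T \<in> BH \<Longrightarrow> T (c *\<^sub>C x) = c *\<^sub>C T x"
  by (simp add: BH_def)

lemma BH_diff: "S \<in> BH \<Longrightarrow> T \<in> BH \<Longrightarrow> S - T \<in> BH"
  by (simp add: BH_def blinfun.diff_left scaleC_diff_right)

lemma BH_compose: "S \<in> BH \<Longrightarrow> T \<in> BH \<Longrightarrow> S o\<^sub>L T \<in> BH"
  by (simp add: BH_def)

text \<open>
  For complex-linear operators a real quadratic form forces self-adjointness, by polarization with
  the vectors \<open>x + \<i> y\<close>. This is the bridge to the results on real spaces.
\<close>

lemma positive_op_iff_psd: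
  assumes "T \<in> BH"
  shows "positive_op T \<longleftrightarrow> psd T"
proof
  assume pos: "positive_op T"
  have Im0: "Im (cinner (T x) x) = 0" and Re0: "0 \<le> Re (cinner (T x) x)" for x
    using pos by (auto simp: positive_op_def complex_nonneg_Reals_iff)
  have "inner (T x) y = inner x (T y)" for x y
    using Im0[of "x + \<i> *\<^sub>C y"] Im0[of x] Im0[of y] inner_commute[of "T y" x]
    by (simp add: blinfun.add_right BH_scaleC[OF assms] cinner_add_left cinner_add_right
        cinner_scaleC_left cinner_scaleC_right inner_eq_Re_cinner)
  with Re0 show "psd T" by (simp add: psd_def inner_eq_Re_cinner)
next
  assume psd: "psd T"
  have "cinner (T x) x \<in> \<real>\<^sub>\<ge>\<^sub>0" for x
  proof -
    have "inner (T x) (\<i> *\<^sub>C x) = inner x (\<i> *\<^sub>C T x)"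
      using psd_symmetric[OF psd] BH_scaleC[OF assms] by simp
    also have "\<dots> = - inner (T x) (\<i> *\<^sub>C x)"
      by (subst inner_commute) (simp add: inner_eq_Re_cinner cinner_scaleC_left cinner_scaleC_right)
    finally show ?thesis
      using psd_nonneg[OF psd] by (simp add: cinner_eq_inner complex_nonneg_Reals_iff)
  qed
  then show "positive_op T" by (simp add: positive_op_def)
qed

text \<open>
  The adjoint for the real inner product of a complex-linear operator is again complex-linear, and
  it is then the adjoint for the complex inner product.
\<close>

lemma cadjoint_characterization:
  assumes T: "T \<in> BH"
  shows cadjoint_BH: "cadjoint T \<in> BH"
    and cinner_cadjoint: "\<And>x y. cinner (T x) y = cinner x (cadjoint T y)"
proof -
  obtain S :: "'a \<Rightarrow>\<^sub>L 'a" where S: "\<And>x y. inner (T x) y = inner x (S y)"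
    using blinfun_adjoint_exists by blast
  have "S (c *\<^sub>C y) = c *\<^sub>C S y" for c y
  proof (rule vector_eq_ldot[THEN iffD1], rule allI)
    fix x
    have "inner x (S (c *\<^sub>C y)) = inner (T (cnj c *\<^sub>C x)) y"
      by (simp add: S[symmetric] BH_scaleC[OF T] inner_scaleC_left)
    also have "\<dots> = inner x (c *\<^sub>C S y)" by (simp add: S inner_scaleC_left)
    finally show "inner x (S (c *\<^sub>C y)) = inner x (c *\<^sub>C S y)" .
  qed
  then have SBH: "S \<in> BH" by (simp add: BH_def)
  have Sc: "cinner (T x) y = cinner x (S y)" for x y
    by (simp add: cinner_eq_inner S BH_scaleC[OF SBH])
  have "cadjoint T = S"
    unfolding cadjoint_def
  proof (rule the_equality)
    fix S' assume "S' \<in> BH \<and> (\<forall>x y. cinner (T x) y = cinner x (S' y))"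
    then have "inner x (S' y) = inner x (S y)" for x y
      by (metis Sc inner_eq_Re_cinner)
    then have "S' y = S y" for y by (metis vector_eq_ldot)
    then show "S' = S" by (rule blinfun_eqI)
  qed (use SBH Sc in simp)
  with SBH Sc show "cadjoint T \<in> BH" "\<And>x y. cinner (T x) y = cinner x (cadjoint T y)"
    by simp_all
qed

lemma inner_cadjoint: "T \<in> BH \<Longrightarrow> inner (T x) y = inner x (cadjoint T y)"
  by (simp add: inner_eq_Re_cinner cinner_cadjoint)

text \<open>
  The square root from the real theory is complex-linear because it commutes with every
  operator that commutes with \<open>T\<^sup>* T\<close>, in particular with the multiplications by complex numbers.
\<close>

lemma modulus_characterization:
  assumes T: "T \<in> BH"
  shows modulus_BH: "modulus T \<in> BH"
    and modulus_psd: "psd (modulus T)"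
    and modulus_commute: "\<And>C. C o\<^sub>L (cadjoint T o\<^sub>L T) = (cadjoint T o\<^sub>L T) o\<^sub>L C \<Longrightarrow>
        C o\<^sub>L modulus T = modulus T o\<^sub>L C"
    and norm_modulus: "\<And>x. norm (modulus T x) = norm (T x)"
proof -
  let ?S = "cadjoint T o\<^sub>L T"
  have SBH: "?S \<in> BH" by (intro BH_compose cadjoint_BH T)
  have "psd ?S"
    unfolding psd_def by (simp add: inner_cadjoint[OF T, symmetric])
      (simp add: inner_commute[of "cadjoint T _"] inner_cadjoint[OF T, symmetric] inner_commute)
  then obtain R where R: "psd R" "R o\<^sub>L R = ?S"
      "\<And>C. C o\<^sub>L ?S = ?S o\<^sub>L C \<Longrightarrow> C o\<^sub>L R = R o\<^sub>L C"
    using psd_sqrt_exists by blast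
  have "R (c *\<^sub>C x) = c *\<^sub>C R x" for c x
  proof -
    let ?C = "Blinfun (\<lambda>x::'a. c *\<^sub>C x)"
    have C: "blinfun_apply ?C x = c *\<^sub>C x" for x
      by (simp add: bounded_linear_Blinfun_apply[OF bounded_linear_scaleC])
    have "?C o\<^sub>L ?S = ?S o\<^sub>L ?C"
      by (rule blinfun_eqI) (use BH_scaleC[OF SBH] in \<open>simp add: C\<close>)
    then have "?C o\<^sub>L R = R o\<^sub>L ?C" by (rule R)
    from arg_cong[OF this, of "\<lambda>T. blinfun_apply T x"] show ?thesis by (simp add: C)
  qed
  then have RBH: "R \<in> BH" by (simp add: BH_def)
  have eq: "modulus T = R"
    unfolding modulus_def
  proof (rule the_equality)
    show "R \<in> BH \<and> positive_op R \<and> R o\<^sub>L R = ?S"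
      using RBH R(1,2) by (simp add: positive_op_iff_psd)
    fix Q assume "Q \<in> BH \<and> positive_op Q \<and> Q o\<^sub>L Q = ?S"
    then have "psd Q" "Q o\<^sub>L Q = R o\<^sub>L R"
      using R(2) positive_op_iff_psd by auto
    then show "Q = R" using R(1) psd_sqrt_unique by blast
  qed
  show "modulus T \<in> BH" "psd (modulus T)"
    unfolding eq by (rule RBH, rule R(1))
  show "C o\<^sub>L modulus T = modulus T o\<^sub>L C" if "C o\<^sub>L ?S = ?S o\<^sub>L C" for C
    unfolding eq using that by (rule R(3))
  show "norm (modulus T x) = norm (T x)" for x
  proof -
    have "inner (R x) (R x) = inner x ((R o\<^sub>L R) x)"
      using psd_symmetric[OF R(1)] by simp
    also have "\<dots> = inner (T x) (T x)"
      unfolding R(2) by (simp add: inner_cadjoint[OF T])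
    finally show ?thesis by (simp add: eq norm_eq_sqrt_inner)
  qed
qed

text \<open>
  This is the operator monotonicity of the square root: the hypothesis says \<open>S\<^sup>* S \<le> T\<^sup>* T\<close>.
\<close>

lemma modulus_le_if_norm_le:
  assumes "S \<in> BH" "T \<in> BH" "\<And>x. norm (S x) \<le> norm (T x)"
  shows "modulus S \<preceq> modulus T"
proof -
  note S = modulus_psd[OF assms(1)] and T = modulus_psd[OF assms(2)]
  have "inner (modulus S x) x \<le> inner (modulus T x) x" for x
    using psd_symmetric[OF S] T assms
    by (intro inner_le_psd_if_norm_le) (simp_all add: norm_modulus)
  then have "psd (modulus T - modulus S)"
    using psd_symmetric[OF S] psd_symmetric[OF T]
    by (simp add: psd_def blinfun.diff_left inner_simps)
  then show ?thesis
    by (simp add: op_le_def positive_op_iff_psd BH_diff modulus_BH assms)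
qed

section \<open>Fuglede's theorem\<close>

text \<open>
  For skew-symmetric \<open>K\<close> the operators \<open>1 + h K\<close> and \<open>1 - h K\<close> are isometric up to second order in \<open>h\<close>,
  and \<open>(1 + h K) T (1 - h K)\<close> differs from \<open>T + h (K T - T K)\<close> by \<open>h\<^sup>2 K T K\<close>. Hence an Euler step for
  the flow \<open>T' = K T - T K\<close> increases the norm only to second order. This replaces the exact isometry
  of conjugation by the unitary group generated by \<open>K\<close>.
\<close>

lemma norm_euler_step_skew_commutator:
  fixes K T :: "'a::real_inner \<Rightarrow> 'a"
  assumes T: "linear T" and K: "linear K"
    and skew: "\<And>x. inner (K x) x = 0"
    and K_le: "\<And>x. norm (K x) \<le> \<kappa> * norm x" and "0 \<le> \<kappa>"
    and T_le: "\<And>x. norm (T x) \<le> M * norm x" and "0 \<le> M"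
  shows "norm (T x + h *\<^sub>R (K (T x) - T (K x))) \<le> (1 + 2 * (h * \<kappa>)\<^sup>2) * M * norm x"
proof -
  define s where "s = sqrt (1 + (h * \<kappa>)\<^sup>2)"
  have s: "s * s = 1 + (h * \<kappa>)\<^sup>2" "0 \<le> s"
    by (simp_all add: s_def)
  have iso: "norm (x + t *\<^sub>R K x) \<le> s * norm x" if "t\<^sup>2 = h\<^sup>2" for t x
  proof (rule power2_le_imp_le)
    have "(norm (x + t *\<^sub>R K x))\<^sup>2 = (norm x)\<^sup>2 + t\<^sup>2 * (norm (K x))\<^sup>2"
      using skew[of x] unfolding power2_norm_eq_inner
      by (simp add: inner_simps inner_commute power2_eq_square)
    also have "\<dots> \<le> (norm x)\<^sup>2 + h\<^sup>2 * (\<kappa> * norm x)\<^sup>2"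
      unfolding that by (intro add_left_mono mult_left_mono power_mono K_le) auto
    also have "\<dots> = (s * norm x)\<^sup>2"
      unfolding power_mult_distrib[of s] power2_eq_square[of s] s(1)
      by (simp add: power_mult_distrib algebra_simps)
    finally show "(norm (x + t *\<^sub>R K x))\<^sup>2 \<le> (s * norm x)\<^sup>2" .
  qed (use s in simp)
  let ?v = "x + (- h) *\<^sub>R K x"
  have "norm (T ?v + h *\<^sub>R K (T ?v)) \<le> s * (M * (s * norm x))"
    using iso[of h "T ?v"] T_le[of ?v] iso[of "- h" x] s(2) \<open>0 \<le> M\<close>
    by (meson mult_left_mono order_trans power2_minus)
  also have "\<dots> = (s * s) * M * norm x" by (simp add: mult_ac)
  finally have 1: "norm (T ?v + h *\<^sub>R K (T ?v)) \<le> (1 + (h * \<kappa>)\<^sup>2) * M * norm x"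
    unfolding s(1) .
  have "norm (K (T (K x))) \<le> \<kappa> * (M * (\<kappa> * norm x))"
    using K_le[of "T (K x)"] T_le[of "K x"] K_le[of x] \<open>0 \<le> \<kappa>\<close> \<open>0 \<le> M\<close>
    by (meson mult_left_mono order_trans)
  then have "norm ((h\<^sup>2) *\<^sub>R K (T (K x))) \<le> h\<^sup>2 * (\<kappa> * (M * (\<kappa> * norm x)))"
    by (simp add: mult_left_mono)
  also have "\<dots> = (h * \<kappa>)\<^sup>2 * M * norm x"
    by (simp add: power2_eq_square mult_ac)
  finally have 2: "norm ((h\<^sup>2) *\<^sub>R K (T (K x))) \<le> (h * \<kappa>)\<^sup>2 * M * norm x" .
  have "T x + h *\<^sub>R (K (T x) - T (K x))
      = (T ?v + h *\<^sub>R K (T ?v)) + (h\<^sup>2) *\<^sub>R K (T (K x))"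
    by (simp add: linear_add[OF T] linear_add[OF K] linear_scale[OF T] linear_scale[OF K]
        linear_diff[OF T] linear_diff[OF K] power2_eq_square algebra_simps)
  also have "norm \<dots> \<le> (1 + (h * \<kappa>)\<^sup>2) * M * norm x + (h * \<kappa>)\<^sup>2 * M * norm x"
    using norm_triangle_ineq 1 2 by (meson add_mono order_trans)
  finally show ?thesis by (simp add: algebra_simps)
qed

text \<open>
  Let \<open>\<delta> T = A\<^sup>* T - T A\<^sup>*\<close>. The function \<open>p(z) = (1 + (z / n) \<delta>)\<^sup>n B\<close> is polynomial in \<open>z\<close> with derivative
  \<open>\<delta> B\<close> at \<open>0\<close>. As \<open>A\<close> is normal and commutes with \<open>B\<close>, it commutes with all iterates, so in each
  factor \<open>z A\<^sup>*\<close> may be replaced by the skew-adjoint operator \<open>K = z A\<^sup>* - cnj z A\<close>. The bound on Euler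
  steps then gives \<open>\<parallel>p(z)\<parallel> \<le> (1 + 2 a\<^sup>2 / n)\<^sup>n \<parallel>B\<parallel> \<le> exp(2 a\<^sup>2) \<parallel>B\<parallel>\<close> on the circle \<open>|z| = sqrt n\<close>, where
  \<open>a = \<parallel>A\<parallel> + \<parallel>A\<^sup>*\<parallel>\<close>. By Cauchy's inequality \<open>\<delta> B\<close> is of order \<open>1 / sqrt n\<close>, for every \<open>n\<close>.
\<close>

lemma fuglede:
  assumes A: "A \<in> BH" and B: "B \<in> BH" and normal: "normal_op A"
    and AB: "A o\<^sub>L B = B o\<^sub>L A"
  shows "cadjoint A o\<^sub>L B = B o\<^sub>L cadjoint A"
proof (rule blinfun_eqI)
  let ?A' = "cadjoint A"
  note A' = cadjoint_BH[OF A]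
  have AA': "A (?A' x) = ?A' (A x)" for x
    using arg_cong[OF normal[unfolded normal_op_def], of "\<lambda>T. blinfun_apply T x"] by simp
  have AB': "A (B x) = B (A x)" for x
    using arg_cong[OF AB, of "\<lambda>T. blinfun_apply T x"] by simp
  have adj: "cinner (?A' x) y = cinner x (A y)" for x y
    by (metis cinner_cadjoint[OF A] cinner_commute)
  have adj': "inner (?A' x) y = inner x (A y)" for x y
    by (simp add: inner_eq_Re_cinner adj)
  define C where "C x = ?A' (B x) - B (?A' x)" for x
  define a where "a = norm A + norm ?A'"
  \<comment> \<open>\<open>p h k z\<close> is \<open>(1 + h z \<delta>)\<^sup>k B\<close>.\<close>
  define p :: "real \<Rightarrow> nat \<Rightarrow> complex \<Rightarrow> 'a \<Rightarrow> 'a" where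
    "p h k z = rec_nat (blinfun_apply B)
      (\<lambda>_ T x. T x + (of_real h * z) *\<^sub>C (?A' (T x) - T (?A' x))) k" for h k z
  have p_simps: "p h 0 z = blinfun_apply B"
    "p h (Suc k) z x = p h k z x + (of_real h * z) *\<^sub>C (?A' (p h k z x) - p h k z (?A' x))"
    for h k z x
    by (simp_all add: p_def)
  have p_add: "p h k z (x + y) = p h k z x + p h k z y" for h k z x y
    by (induction k arbitrary: x y)
      (simp_all add: p_simps blinfun.add_right scaleC_add_right scaleC_diff_right)
  have p_scaleC: "p h k z (c *\<^sub>C x) = c *\<^sub>C p h k z x" for h k z c x
    by (induction k arbitrary: x)
      (simp_all add: p_simps BH_scaleC[OF B] BH_scaleC[OF A'] scaleC_add_right scaleC_diff_right
        scaleC_scaleC mult.commute)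
  have p_linear: "linear (p h k z)" for h k z
    by (rule linearI) (simp_all add: p_add p_scaleC scaleR_eq_scaleC)
  have p_A: "A (p h k z x) = p h k z (A x)" for h k z x
    by (induction k arbitrary: x)
      (simp_all add: p_simps AB' BH_scaleC[OF A] blinfun.add_right blinfun.diff_right AA')
  have p_le: "norm (p h k z x) \<le> (1 + 2 * (h * (cmod z * a))\<^sup>2) ^ k * norm B * norm x" for h k z x
  proof (induction k arbitrary: x)
    case 0
    show ?case using norm_blinfun[of B x] by (simp add: p_simps)
  next
    case (Suc k)
    define K where "K x = z *\<^sub>C ?A' x - cnj z *\<^sub>C A x" for x
    have "linear K"
      by (rule linearI)
        (simp_all add: K_def blinfun.add_right blinfun.scaleR_right scaleC_add_right
          scaleR_eq_scaleC scaleC_scaleC mult.commute scaleC_diff_right BH_scaleC[OF A]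
          BH_scaleC[OF A'])
    moreover have "inner (K x) x = 0" for x
    proof -
      have "inner (z *\<^sub>C ?A' x) x = inner x (cnj z *\<^sub>C A x)"
        by (simp add: inner_scaleC_left adj' BH_scaleC[OF A])
      then show ?thesis
        by (simp add: K_def inner_diff_left inner_commute[of "cnj z *\<^sub>C A x"])
    qed
    moreover have "norm (K x) \<le> (cmod z * a) * norm x" for x
    proof -
      have "norm (K x) \<le> cmod z * norm (?A' x) + cmod z * norm (A x)"
        unfolding K_def by (rule order_trans[OF norm_triangle_ineq4]) (simp add: norm_scaleC)
      also have "\<dots> \<le> cmod z * (norm ?A' * norm x) + cmod z * (norm A * norm x)"
        by (intro add_mono mult_left_mono norm_blinfun) auto
      finally show ?thesis by (simp add: a_def algebra_simps)
    qed
    ultimately have "norm (p h k z x + h *\<^sub>R (K (p h k z x) - p h k z (K x)))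
        \<le> (1 + 2 * (h * (cmod z * a))\<^sup>2) * ((1 + 2 * (h * (cmod z * a))\<^sup>2) ^ k * norm B) * norm x"
      using Suc p_linear
      by (intro norm_euler_step_skew_commutator) (auto simp: a_def)
    moreover have "K (p h k z x) - p h k z (K x) = z *\<^sub>C (?A' (p h k z x) - p h k z (?A' x))"
      by (simp add: K_def linear_diff[OF p_linear] p_scaleC p_A scaleC_diff_right)
    ultimately show ?case
      by (simp add: p_simps scaleR_eq_scaleC scaleC_scaleC mult_ac)
  qed
  \<comment> \<open>Moving the outer \<open>A\<^sup>*\<close> to the second argument makes the matrix coefficients of \<open>p\<close> satisfy a
    recursion among themselves, from which holomorphy and the derivative at \<open>0\<close> follow by induction.\<close>
  have p_cinner_Suc: "cinner (p h (Suc k) z x) y = cinner (p h k z x) y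
      + of_real h * z * (cinner (p h k z x) (A y) - cinner (p h k z (?A' x)) y)" for h k z x y
  proof -
    have cinner_diff: "cinner (u - v) y = cinner u y - cinner v y" for u v
      using cinner_add_left[of "u - v" v y] by simp
    show ?thesis
      by (simp add: p_simps cinner_add_left cinner_scaleC_left cinner_diff adj)
  qed
  have p_holo: "(\<lambda>z. cinner (p h k z x) y) holomorphic_on UNIV" for h k x y
    by (induction k arbitrary: x y)
      (auto simp: p_simps(1) p_cinner_Suc intro!: holomorphic_intros)
  have p0: "p h k 0 x = B x" for h k x
  proof -
    have "0 *\<^sub>C u = 0" for u :: 'a
      using scaleR_eq_scaleC[of 0 u] by simp
    then show ?thesis
      by (induction k arbitrary: x) (simp_all add: p_simps)
  qed
  have p_deriv: "((\<lambda>z. cinner (p h k z x) y) has_field_derivative of_real (k * h) * cinner (C x) y)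
      (at 0)" for h k x y
  proof (induction k arbitrary: x y)
    case 0
    show ?case by (simp add: p_simps)
  next
    case (Suc k)
    have C: "cinner (C x) y = cinner (B x) (A y) - cinner (B (?A' x)) y"
      using cinner_add_left[of "C x" "B (?A' x)" y] by (simp add: C_def adj)
    show ?case
      unfolding p_cinner_Suc
      by (auto intro!: derivative_eq_intros Suc simp: p0 C algebra_simps)
  qed
  have small: "cmod (cinner (C x) y) \<le> exp (2 * a\<^sup>2) * norm B * norm x * norm y / sqrt n"
    if n: "0 < n" for n :: nat and x y
  proof -
    define G where "G = exp (2 * a\<^sup>2) * norm B * norm x * norm y"
    let ?f = "\<lambda>z. cinner (p (1 / n) n z x) y"
    have "cmod ((deriv ^^ 1) ?f 0) \<le> fact 1 * G / sqrt n ^ 1"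
    proof (rule Cauchy_inequality)
      show "?f holomorphic_on ball 0 (sqrt n)"
        using p_holo by (rule holomorphic_on_subset) auto
      show "continuous_on (cball 0 (sqrt n)) ?f"
        using holomorphic_on_imp_continuous_on[OF p_holo] by (rule continuous_on_subset) auto
      show "0 < sqrt n" using n by simp
      fix z :: complex assume "cmod (0 - z) = sqrt n"
      then have z: "cmod z = sqrt n" by simp
      have "2 * (1 / n * (cmod z * a))\<^sup>2 = 2 * a\<^sup>2 / n"
        using n unfolding z by (simp add: power_mult_distrib power2_eq_square field_simps)
      then have "(1 + 2 * (1 / n * (cmod z * a))\<^sup>2) ^ n \<le> exp (2 * a\<^sup>2)"
        using exp_ge_one_plus_x_over_n_power_n[of n "2 * a\<^sup>2"] n
        by (simp add: order_trans[of "- real n" 0])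
      then have "norm (p (1 / n) n z x) \<le> exp (2 * a\<^sup>2) * norm B * norm x"
        by (intro order_trans[OF p_le] mult_right_mono) auto
      then show "cmod (?f z) \<le> G"
        unfolding G_def by (intro order_trans[OF norm_cinner_le] mult_right_mono) auto
    qed
    moreover have "(deriv ^^ 1) ?f 0 = cinner (C x) y"
      using DERIV_imp_deriv[OF p_deriv[of "1 / n" n x y]] n by simp
    ultimately show ?thesis by (simp add: G_def)
  qed
  fix x
  define G where "G = exp (2 * a\<^sup>2) * norm B * norm x * norm (C x)"
  have "filterlim (\<lambda>n. sqrt (real n)) at_top sequentially"
    by (intro filterlim_compose[OF sqrt_at_top] filterlim_real_sequentially)
  then have "(\<lambda>n. G / sqrt n) \<longlonglongrightarrow> 0"
    by (intro tendsto_divide_0[OF tendsto_const] filterlim_at_top_imp_at_infinity)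
  then have "cmod (cinner (C x) (C x)) \<le> 0"
    by (rule LIMSEQ_le_const) (use small[of _ x "C x"] in \<open>auto simp: G_def intro!: exI[of _ 1]\<close>)
  then have "inner (C x) (C x) = 0" by (simp add: inner_eq_Re_cinner)
  then show "(?A' o\<^sub>L B) x = (B o\<^sub>L ?A') x" by (simp add: C_def)
qed

section \<open>Commuting normal and hyponormal operators\<close>

lemma norm_normal_op:
  assumes "T \<in> BH" "normal_op T"
  shows "norm (cadjoint T x) = norm (T x)"
proof -
  have "inner (cadjoint T x) (cadjoint T x) = inner ((T o\<^sub>L cadjoint T) x) x"
    by (simp add: inner_cadjoint[OF assms(1)])
  also have "\<dots> = inner (T x) (T x)"
    using assms(2) by (simp add: normal_op_def inner_commute inner_cadjoint[OF assms(1)])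
  finally show ?thesis by (simp add: norm_eq_sqrt_inner)
qed

lemma norm_hyponormal_op:
  assumes T: "T \<in> BH" "hyponormal_op T"
  shows "norm (cadjoint T x) \<le> norm (T x)"
proof -
  have "psd ((cadjoint T o\<^sub>L T) - (T o\<^sub>L cadjoint T))"
    using T by (simp add: hyponormal_op_def op_le_def positive_op_iff_psd BH_diff BH_compose cadjoint_BH)
  then have "0 \<le> inner (((cadjoint T o\<^sub>L T) - (T o\<^sub>L cadjoint T)) x) x"
    by (rule psd_nonneg)
  moreover have "inner (cadjoint T (T x)) x = inner (T x) (T x)"
    by (metis inner_cadjoint[OF T(1)] inner_commute)
  ultimately have "inner (cadjoint T x) (cadjoint T x) \<le> inner (T x) (T x)"
    by (simp add: blinfun.diff_left inner_diff_left inner_cadjoint[OF T(1)])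
  then show ?thesis by (simp add: norm_eq_sqrt_inner)
qed

text \<open>
  The left-hand side is the quadratic form of \<open>S = Re (A\<^sup>* B)\<close> and the right-hand side that of \<open>P Q\<close>.
  The comparison principle applies because \<open>\<parallel>A\<^sup>* B x\<parallel> = \<parallel>A B x\<parallel> = \<parallel>P Q x\<parallel>\<close> and
  \<open>\<parallel>B\<^sup>* A x\<parallel> = \<parallel>B\<^sup>* P x\<parallel> \<le> \<parallel>B P x\<parallel> = \<parallel>P Q x\<parallel>\<close>; the inequality is hyponormality, and the equalities use
  that \<open>P\<close> commutes with \<open>B\<close> and \<open>B\<^sup>*\<close> by Fuglede's theorem.
\<close>

lemma inner_le_inner_modulus:
  assumes A: "A \<in> BH" and B: "B \<in> BH" and AB: "A o\<^sub>L B = B o\<^sub>L A"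
    and normal: "normal_op A" and hypo: "hyponormal_op B"
  shows "inner (A x) (B x) \<le> inner (modulus A x) (modulus B x)"
proof -
  let ?A' = "cadjoint A" and ?B' = "cadjoint B" and ?P = "modulus A" and ?Q = "modulus B"
  have AA': "A (?A' x) = ?A' (A x)" for x
    using arg_cong[OF normal[unfolded normal_op_def], of "\<lambda>T. blinfun_apply T x"] by simp
  have AB': "A (B x) = B (A x)" for x
    using arg_cong[OF AB, of "\<lambda>T. blinfun_apply T x"] by simp
  have A'B: "?A' (B x) = B (?A' x)" for x
    using arg_cong[OF fuglede[OF A B normal AB], of "\<lambda>T. blinfun_apply T x"] by simp
  have adjA: "inner (?A' x) y = inner x (A y)" and adjB: "inner (?B' x) y = inner x (B y)" for x y
    by (metis inner_cadjoint A B inner_commute)+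
  have B'A: "?B' (A x) = A (?B' x)" for x
    by (rule vector_eq_ldot[THEN iffD1])
      (simp add: adjA[symmetric] inner_cadjoint[OF B, symmetric] A'B)
  have B'A': "?B' (?A' x) = ?A' (?B' x)" for x
    by (rule vector_eq_ldot[THEN iffD1])
      (simp add: inner_cadjoint[OF A, symmetric] inner_cadjoint[OF B, symmetric] AB')
  have "B o\<^sub>L ?P = ?P o\<^sub>L B" "?B' o\<^sub>L ?P = ?P o\<^sub>L ?B'"
    by (intro modulus_commute A blinfun_eqI; simp add: AB' A'B B'A B'A')+
  then have BP: "B (?P x) = ?P (B x)" and B'P: "?B' (?P x) = ?P (?B' x)" for x
    by (metis blinfun_apply_blinfun_compose)+
  have PQ: "?P o\<^sub>L ?Q = ?Q o\<^sub>L ?P"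
    by (intro modulus_commute B blinfun_eqI) (simp add: BP B'P)
  have PQ': "?P (?Q x) = ?Q (?P x)" for x
    using arg_cong[OF PQ, of "\<lambda>T. blinfun_apply T x"] by simp
  have psdPQ: "psd (?P o\<^sub>L ?Q)"
    by (intro psd_compose_commuting modulus_psd A B PQ)
  define S where "S = (1/2) *\<^sub>R ((?A' o\<^sub>L B) + (?B' o\<^sub>L A))"
  have S_apply: "S x = (1/2) *\<^sub>R (?A' (B x) + ?B' (A x))" for x
    by (simp add: S_def blinfun.scaleR_left blinfun.add_left)
  have "inner (S x) x \<le> inner ((?P o\<^sub>L ?Q) x) x"
  proof (rule inner_le_psd_if_norm_le[OF _ psdPQ])
    show "inner (S x) y = inner x (S y)" for x y
      by (simp add: S_apply inner_add_left inner_add_right adjA adjB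
          inner_cadjoint[OF A, symmetric] inner_cadjoint[OF B, symmetric] add.commute)
    show "norm (S x) \<le> norm ((?P o\<^sub>L ?Q) x)" for x
    proof -
      have 1: "norm (?A' (B x)) = norm (?Q (?P x))"
        by (simp add: norm_normal_op[OF A normal] norm_modulus[OF B] BP norm_modulus[OF A])
      have "norm (?B' (A x)) = norm (?B' (?P x))"
        by (simp add: B'A B'P norm_modulus[OF A])
      also have "\<dots> \<le> norm (?Q (?P x))"
        by (simp add: norm_modulus[OF B] norm_hyponormal_op[OF B hypo])
      finally show ?thesis
        using norm_triangle_ineq[of "?A' (B x)" "?B' (A x)"] 1
        by (simp add: S_apply PQ')
    qed
  qed
  moreover have "inner (S x) x = inner (A x) (B x)"
    by (simp add: S_apply inner_add_left adjA adjB inner_commute[of "B x"])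
  moreover have "inner ((?P o\<^sub>L ?Q) x) x = inner (?P x) (?Q x)"
    using psd_symmetric[OF modulus_psd[OF A], of "?Q x" x] by (simp add: inner_commute)
  ultimately show ?thesis by simp
qed

theorem proposition3p12:
  fixes A B :: "'a::complex_hilbert_space \<Rightarrow>\<^sub>L 'a"
  assumes "A \<in> BH" and "B \<in> BH"
    and "A o\<^sub>L B = B o\<^sub>L A"
    and "normal_op A"
    and "hyponormal_op B"
  shows "modulus (modulus A - modulus B) \<preceq> modulus (A - B)"
proof (rule modulus_le_if_norm_le)
  fix x
  have expand: "(norm (u - v))\<^sup>2 = (norm u)\<^sup>2 - 2 * inner u v + (norm v)\<^sup>2" for u v :: 'a
    unfolding power2_norm_eq_inner by (simp add: inner_simps inner_commute)
  have "(norm (modulus A x - modulus B x))\<^sup>2 \<le> (norm (A x - B x))\<^sup>2"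
    using inner_le_inner_modulus[OF assms, of x] assms(1,2)
    by (simp add: expand norm_modulus)
  then have "norm (modulus A x - modulus B x) \<le> norm (A x - B x)"
    by (rule power2_le_imp_le) simp
  then show "norm ((modulus A - modulus B) x) \<le> norm ((A - B) x)"
    by (simp add: blinfun.diff_left)
qed (use assms in \<open>simp_all add: BH_diff modulus_BH\<close>)

end
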